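(* Let $G_{2,2}$ be the double-star tree consisting of two adjacent hubs $u_1,u_2$, each with two pendant leaves attached. Then $G_{2,2}$ has six vertices and the first-passage location game on it has no pure Nash equilibrium. Its complete optimal-strategy set is $$\mathcal O(G_{2,2})=\left\{p\,\delta_{u_1}+(1-p)\,\delta_{u_2}:\ \frac{228}{2153}\le p\le\frac{1925}{2153}\right\}.$$ In particular, every optimal strategy randomizes over both hubs.
   Context: Walk: on a finite connected graph $G=(V,E)$ the constant-speed walk waits at each vertex an exponential time of mean one and then jumps to a uniformly random neighbor (so a leaf also has total jump rate one). Payoffs: for independent walks started at $a,b\in V$, let $\tau_z^{(a)},\tau_z^{(b)}$ be the first hitting times of $z\in V$ (equal to $0$ if the start is $z$), and set $$q_z(a,b)=\Pr(\tau_z^{(a)}<\tau_z^{(b)})+\tfrac12\Pr(\tau_z^{(a)}=\tau_z^{(b)}),\qquad U_G(a,b)=\sum_{z\in V}q_z(a,b),\qquad A_G(a,b)=U_G(a,b)-\tfrac{|V|}{2}.$$ Co-location is permitted, with the two walks independent given their common start. Game: two players simultaneously choose starting vertices $a$ and $b$ (or probability distributions over vertices); they receive $U_G(a,b)$ and $U_G(b,a)=|V|-U_G(a,b)$. A pure Nash equilibrium is a pair of vertices from which neither player can strictly gain by a unilateral change. Optimal strategies: $$\mathcal O(G)=\Bigl\{\mu\in\mathcal P(V):\ \sum_{a\in V}\mu(a)A_G(a,b)\ge 0\ \text{ for every } b\in V\Bigr\},$$ where $\mathcal P(V)$ is the set of probability measures on $V$. *)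

theory Defs
  imports
    "HOL-Probability.Probability"
    "HOL-Library.Countable"
    "Graph_Theory.Pair_Digraph"
    "Graph_Theory.Digraph_Component"
begin

text \<open>
  Finite simple graphs are the symmetric loop-free pair digraphs of the locale
  \<^locale>\<open>pair_graph\<close>: an undirected edge is a pair of opposite arcs.
\<close>

definition neighbors :: "'v pair_pre_digraph \<Rightarrow> 'v \<Rightarrow> 'v set" where
  "neighbors G v = {w. (v, w) \<in> parcs G}"

text \<open>
  The walk is driven by i.i.d. steps \<open>(f, t)\<close>, one for each jump: \<open>t\<close> is the holding time
  before the jump, and the jump goes from the current vertex \<open>v\<close> to \<open>f v\<close>, where the values
  \<open>f v\<close> are uniformly random neighbors of \<open>v\<close>. Each \<open>f\<close> is evaluated at one vertex only,
  so this is the usual random-mapping construction of the jump chain.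
  The vertex type is countable so that the position after \<open>n\<close> jumps is measurable.
\<close>

type_synonym 'v walk_path = "nat \<Rightarrow> ('v \<Rightarrow> 'v) \<times> real"

definition step_law :: "('v::countable) pair_pre_digraph \<Rightarrow> (('v \<Rightarrow> 'v) \<times> real) measure" where
  "step_law G =
     measure_pmf (Pi_pmf (pverts G) undefined (\<lambda>v. pmf_of_set (neighbors G v)))
       \<Otimes>\<^sub>M density lborel (\<lambda>t. ennreal (exponential_density 1 t))"

definition walk_law :: "('v::countable) pair_pre_digraph \<Rightarrow> 'v walk_path measure" where
  "walk_law G = PiM UNIV (\<lambda>_. step_law G)"

primrec jump_chain :: "'v \<Rightarrow> 'v walk_path \<Rightarrow> nat \<Rightarrow> 'v" where
  "jump_chain a \<omega> 0 = a"
| "jump_chain a \<omega> (Suc n) = fst (\<omega> n) (jump_chain a \<omega> n)"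

definition jump_time :: "'v walk_path \<Rightarrow> nat \<Rightarrow> real" where
  "jump_time \<omega> n = (\<Sum>i<n. snd (\<omega> i))"

definition walk_at :: "'v \<Rightarrow> 'v walk_path \<Rightarrow> real \<Rightarrow> 'v \<Rightarrow> bool" where
  "walk_at a \<omega> t v \<longleftrightarrow>
     (\<exists>n. jump_time \<omega> n \<le> t \<and> t < jump_time \<omega> (Suc n) \<and> jump_chain a \<omega> n = v)"

text \<open>The hitting time is \<open>\<infinity>\<close> if the vertex is never visited.\<close>

definition hitting_time :: "'v \<Rightarrow> 'v \<Rightarrow> 'v walk_path \<Rightarrow> ereal" where
  "hitting_time z a \<omega> = Inf (ereal ` {t. 0 \<le> t \<and> walk_at a \<omega> t z})"

text \<open>
  The two walks are independent, including when \<open>a = b\<close>: they are driven by the two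
  coordinates of a product measure.
\<close>

definition first_passage_prob :: "('v::countable) pair_pre_digraph \<Rightarrow> 'v \<Rightarrow> 'v \<Rightarrow> 'v \<Rightarrow> real" where
  "first_passage_prob G z a b =
     \<P>(\<omega> in walk_law G \<Otimes>\<^sub>M walk_law G.
        hitting_time z a (fst \<omega>) < hitting_time z b (snd \<omega>))
     + 1 / 2 * \<P>(\<omega> in walk_law G \<Otimes>\<^sub>M walk_law G.
        hitting_time z a (fst \<omega>) = hitting_time z b (snd \<omega>))"

definition payoff :: "('v::countable) pair_pre_digraph \<Rightarrow> 'v \<Rightarrow> 'v \<Rightarrow> real" where
  "payoff G a b = (\<Sum>z\<in>pverts G. first_passage_prob G z a b)"

definition advantage :: "('v::countable) pair_pre_digraph \<Rightarrow> 'v \<Rightarrow> 'v \<Rightarrow> real" where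
  "advantage G a b = payoff G a b - real (card (pverts G)) / 2"

definition pure_nash :: "('v::countable) pair_pre_digraph \<Rightarrow> 'v \<Rightarrow> 'v \<Rightarrow> bool" where
  "pure_nash G a b \<longleftrightarrow>
     a \<in> pverts G \<and> b \<in> pverts G
     \<and> (\<forall>a'\<in>pverts G. payoff G a' b \<le> payoff G a b)
     \<and> (\<forall>b'\<in>pverts G. payoff G b' a \<le> payoff G b a)"

definition optimal_strategies :: "('v::countable) pair_pre_digraph \<Rightarrow> 'v pmf set" where
  "optimal_strategies G =
     {\<mu>. set_pmf \<mu> \<subseteq> pverts G
        \<and> (\<forall>b\<in>pverts G. 0 \<le> (\<Sum>a\<in>pverts G. pmf \<mu> a * advantage G a b))}"

datatype ds_vertex = Hub1 | Hub2 | Leaf1 nat | Leaf2 nat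

instance ds_vertex :: countable
  by countable_datatype

definition double_star :: "nat \<Rightarrow> nat \<Rightarrow> ds_vertex pair_pre_digraph" where
  "double_star m n =
     (let E = {(Hub1, Hub2)} \<union> (\<lambda>i. (Hub1, Leaf1 i)) ` {..<m} \<union> (\<lambda>i. (Hub2, Leaf2 i)) ` {..<n}
      in \<lparr>pverts = {Hub1, Hub2} \<union> Leaf1 ` {..<m} \<union> Leaf2 ` {..<n}, parcs = E \<union> E\<inverse>\<rparr>)"

lemma pair_graph_double_star: "pair_graph (double_star m n)"
  by unfold_locales (auto simp: double_star_def Let_def symmetric_def intro!: symI)

lemma connected_double_star: "connected (with_proj (double_star m n))"
proof -
  interpret pair_graph "double_star m n"
    by (rule pair_graph_double_star)
  have arc: "u \<rightarrow>\<^sup>*\<^bsub>with_proj (double_star m n)\<^esub> v" if "(u, v) \<in> parcs (double_star m n)" for u v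
    using that by (intro reachable_adjI) simp
  have hub: "Hub1 \<rightarrow>\<^sup>*\<^bsub>with_proj (double_star m n)\<^esub> v" if "v \<in> pverts (double_star m n)" for v
  proof -
    have "Hub1 = v \<or> (Hub1, v) \<in> parcs (double_star m n)
        \<or> (Hub1, Hub2) \<in> parcs (double_star m n) \<and> (Hub2, v) \<in> parcs (double_star m n)"
      using that by (auto simp: double_star_def Let_def)
    then show ?thesis
      using arc that reachable_trans by (metis reachable_refl with_proj_simps(1))
  qed
  have "strongly_connected (with_proj (double_star m n))"
  proof (rule strongly_connectedI)
    show "verts (with_proj (double_star m n)) \<noteq> {}"
      by (simp add: double_star_def Let_def)
  next
    fix u v
    assume "u \<in> verts (with_proj (double_star m n))" "v \<in> verts (with_proj (double_star m n))"
    then show "u \<rightarrow>\<^sup>*\<^bsub>with_proj (double_star m n)\<^esub> v"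
      using hub symmetric_reachable' reachable_trans by (metis with_proj_simps(1))
  qed
  moreover have "mk_symmetric (with_proj (double_star m n)) = double_star m n"
    by (intro pair_pre_digraph.equality) (fastforce simp: mk_symmetric_def double_star_def Let_def)+
  ultimately show ?thesis
    by (simp add: connected_def)
qed

end

theory Submission
  imports Defs
begin

text \<open>
  For a target \<open>z\<close>, the probability \<open>h a b\<close> that the walk from \<open>a\<close> hits \<open>z\<close> before the walk from \<open>b\<close>
  (ties counted one half) is harmonic for the pair of walks in which a fair coin decides who jumps:
  off \<open>z\<close>, \<open>h a b\<close> is the mean of the neighbor averages of \<open>h\<close> in the first and in the second
  argument. This comes from a deterministic identity for delaying two arrival times by independent
  exponentials, integrated over the hitting times after the first jump; no almost sure finiteness
  of the hitting times is needed. For the double star the symmetries leave two small linear systems,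
  one for a hub target and one for a leaf target, which yield the payoff matrix. A hub beats its own
  leaves by \<open>385/1812\<close> and loses to the other hub's leaves by \<open>19/755\<close>, and \<open>385/1812 : 19/755 = 1925 : 228\<close>.
\<close>

subsection \<open>Races delayed by exponential clocks\<close>

abbreviation expo :: "real measure" where
  "expo \<equiv> density lborel (\<lambda>t. ennreal (exponential_density 1 t))"

text \<open>Arguments are extended reals because a vertex may never be hit; two infinite arrival
  times count as a tie. Values in \<open>ennreal\<close> keep the integrals below free of
  integrability conditions.\<close>

definition score :: "ereal \<Rightarrow> ereal \<Rightarrow> ennreal" where
  "score m n = (if m < n then 1 else if m = n then ennreal (1/2) else 0)"

lemma measurable_score [measurable]:
  assumes [measurable]: "f \<in> borel_measurable M" "g \<in> borel_measurable M"
  shows "(\<lambda>x. score (f x) (g x)) \<in> borel_measurable M"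
  unfolding score_def by measurable

lemma prob_space_expo: "prob_space expo"
  by (rule prob_space_exponential_density) simp

lemma AE_expo_nonneg: "AE t in expo. 0 \<le> t"
  by (subst AE_density) (auto simp: exponential_density_def)

lemma AE_expo_neq: "AE t in expo. t \<noteq> a"
  using AE_lborel_singleton[of a] by (subst AE_density) auto

lemma AE_expo_pos: "AE t in expo. 0 < t"
  using AE_expo_nonneg AE_expo_neq[of 0] by eventually_elim simp

text \<open>The antiderivative \<open>- exp (- k * t) / k\<close> vanishes at infinity. The rate
  used below is \<open>k = 2\<close>, from the density of one clock times the tail of the
  other.\<close>

lemma nn_integral_exp_tail:
  fixes a k :: real
  assumes "k > 0"
  shows "(\<integral>\<^sup>+t. ennreal (exp (- k * t)) * indicator {a..} t \<partial>lborel) = ennreal (exp (- k * a) / k)"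
proof -
  have lim: "((\<lambda>t. - exp (- k * t) / k) \<longlongrightarrow> 0) at_top"
  proof -
    have "LIM t at_top. - k * t :> at_bot"
      using assms by (intro filterlim_tendsto_neg_mult_at_bot[OF tendsto_const] filterlim_ident) auto
    from filterlim_compose[OF exp_at_bot this] show ?thesis
      by (auto intro!: tendsto_divide_zero tendsto_minus_cancel_left[THEN iffD1] simp: tendsto_minus_cancel_left)
  qed
  have "(\<integral>\<^sup>+t. ennreal (exp (- k * t)) * indicator {a..} t \<partial>lborel)
      = ennreal (0 - (- exp (- k * a) / k))"
    using assms by (intro nn_integral_FTC_atLeast lim) (auto intro!: derivative_eq_intros)
  then show ?thesis by simp
qed

lemma emeasure_expo_atMost: "emeasure expo {..a} = ennreal (if a < 0 then 0 else 1 - exp (- a))"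
  by (subst emeasure_erlang_density) (auto simp: erlang_CDF_0)

lemma emeasure_expo_greaterThan: "emeasure expo {a<..} = ennreal (if a < 0 then 1 else exp (- a))"
proof -
  interpret prob_space expo by (rule prob_space_expo)
  have "{a<..} = space expo - {..a}" by auto
  then have "emeasure expo {a<..} = 1 - emeasure expo {..a}"
    using emeasure_compl[of "{..a}" expo] emeasure_space_1 by (simp add: emeasure_expo_atMost)
  also have "\<dots> = ennreal (if a < 0 then 1 else exp (- a))"
    by (auto simp: emeasure_expo_atMost ennreal_minus simp flip: ennreal_1)
  finally show ?thesis .
qed

text \<open>A tie requires \<open>t = m - n\<close>, a null event, so the score is almost surely the
  indicator of \<open>t > m - n\<close> and its mean is an exponential tail.\<close>

lemma nn_integral_score_delay_right:
  fixes m n :: real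
  shows "(\<integral>\<^sup>+t. score m (ereal t + n) \<partial>expo) = ennreal (if m < n then 1 else exp (n - m))"
proof -
  have "(\<integral>\<^sup>+t. score m (ereal t + n) \<partial>expo) = (\<integral>\<^sup>+t. indicator {m - n<..} t \<partial>expo)"
    using AE_expo_neq[of "m - n"]
    by (intro nn_integral_cong_AE) (auto simp: score_def indicator_def elim!: eventually_mono)
  also have "\<dots> = ennreal (if m < n then 1 else exp (n - m))"
    by (subst nn_integral_indicator) (auto simp: emeasure_expo_greaterThan)
  finally show ?thesis .
qed

lemma nn_integral_score_delay_left:
  fixes m n :: real
  shows "(\<integral>\<^sup>+t. score (ereal t + m) n \<partial>expo) = ennreal (if n < m then 0 else 1 - exp (m - n))"
proof -
  have "(\<integral>\<^sup>+t. score (ereal t + m) n \<partial>expo) = (\<integral>\<^sup>+t. indicator {..n - m} t \<partial>expo)"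
  proof (intro nn_integral_cong_AE)
    show "AE t in expo. score (ereal t + m) n = indicator {..n - m} t"
      using AE_expo_neq[of "n - m"] by eventually_elim (auto simp: score_def)
  qed
  also have "\<dots> = ennreal (if n < m then 0 else 1 - exp (m - n))"
    by (subst nn_integral_indicator) (auto simp: emeasure_expo_atMost)
  finally show ?thesis .
qed

lemma nn_integral_score_delay_both:
  fixes m n :: real
  shows "(\<integral>\<^sup>+s. (\<integral>\<^sup>+t. score (ereal s + m) (ereal t + n) \<partial>expo) \<partial>expo)
      = ennreal (if m < n then 1 - exp (m - n) / 2 else exp (n - m) / 2)"
proof -
  \<comment> \<open>The range \<open>s \<ge> n - m\<close> is cut at 0, because the density vanishes
    on negative times.\<close>
  let ?c = "max 0 (n - m)"
  have "(\<integral>\<^sup>+s. (\<integral>\<^sup>+t. score (ereal s + m) (ereal t + n) \<partial>expo) \<partial>expo)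
      = (\<integral>\<^sup>+s. ennreal (if s + m < n then 1 else exp (n - (s + m))) \<partial>expo)"
    using nn_integral_score_delay_right[of "s + m" n for s] by simp
  also have "\<dots> = (\<integral>\<^sup>+s. ennreal (exponential_density 1 s)
      * ennreal (if s + m < n then 1 else exp (n - (s + m))) \<partial>lborel)"
    by (subst nn_integral_density) auto
  \<comment> \<open>Below \<open>n - m\<close> the inner integral is 1; above it, density times tail
    is \<open>exp (n - m) * exp (- 2 * s)\<close>. At the point \<open>n - m\<close> both indicators
    can be 1, hence equality only almost everywhere.\<close>
  also have "\<dots> = (\<integral>\<^sup>+s. ennreal (exponential_density 1 s) * indicator {..n - m} s
      + ennreal (exp (n - m)) * (ennreal (exp (- 2 * s)) * indicator {?c..} s) \<partial>lborel)"
    using AE_lborel_singleton[of "n - m"]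
    by (intro nn_integral_cong_AE)
       (auto simp: exponential_density_def indicator_def ennreal_mult[symmetric]
          exp_add[symmetric] exp_diff[symmetric] elim!: eventually_mono)
  also have "\<dots> = emeasure expo {..n - m} + ennreal (exp (n - m)) * ennreal (exp (- 2 * ?c) / 2)"
    using nn_integral_exp_tail[of 2 ?c]
    by (subst nn_integral_add) (auto simp: nn_integral_cmult emeasure_density)
  also have "\<dots> = ennreal (if m < n then 1 - exp (m - n) / 2 else exp (n - m) / 2)"
    by (auto simp: emeasure_expo_atMost ennreal_mult[symmetric] ennreal_plus[symmetric]
          exp_add[symmetric] simp del: ennreal_plus)
  finally show ?thesis .
qed

lemma ennreal_average:
  assumes "0 \<le> b" "0 \<le> c"
  shows "ennreal (1/2) * ennreal b + ennreal (1/2) * ennreal c = ennreal ((b + c) / 2)"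
  using assms by (simp only: ennreal_mult[symmetric] ennreal_plus[symmetric])
    (simp add: field_simps flip: ennreal_mult ennreal_plus)

text \<open>This is memorylessness: either clock rings first with probability 1/2, the other clock
  then has a fresh exponential time left, and subtracting the elapsed time keeps the order of
  arrivals. For finite \<open>m\<close> and \<open>n\<close> the proof compares the closed forms
  computed above.\<close>

lemma score_delay:
  "(\<integral>\<^sup>+s. (\<integral>\<^sup>+t. score (ereal s + m) (ereal t + n) \<partial>expo) \<partial>expo)
    = ennreal (1/2) * (\<integral>\<^sup>+t. score m (ereal t + n) \<partial>expo)
    + ennreal (1/2) * (\<integral>\<^sup>+s. score (ereal s + m) n \<partial>expo)"
proof -
  interpret prob_space expo by (rule prob_space_expo)
  have "ennreal (1/2) + ennreal (1/2) = 1"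
    by (subst ennreal_plus[symmetric]) auto
  then have half: "ennreal (1/2) * a + ennreal (1/2) * a = a" for a
    by (metis distrib_right mult_1)
  have const: "(\<integral>\<^sup>+t. c \<partial>expo) = c" for c
    using emeasure_space_1 by simp
  show ?thesis
  proof (cases "\<bar>m\<bar> = \<infinity> \<or> \<bar>n\<bar> = \<infinity>")
    case True
    \<comment> \<open>Finite delays cannot change the order once an arrival time is infinite, so all
      the integrands are the same constant.\<close>
    have *: "score (ereal s + m) (ereal t + n) = score m n" "score (ereal s + m) n = score m n"
      "score m (ereal t + n) = score m n" for s t
      using True by (cases m; cases n; simp add: score_def)+
    show ?thesis
      by (simp only: * const half)
  next
    case False
    then obtain m' n' where mn: "m = ereal m'" "n = ereal n'"
      by (cases m; cases n; auto)
    show ?thesis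
      unfolding mn nn_integral_score_delay_right nn_integral_score_delay_left
        nn_integral_score_delay_both
      by (subst ennreal_average) (auto simp: field_simps)
  qed
qed

subsection \<open>First-step decomposition of the hitting time\<close>

text \<open>The first stay at \<open>z\<close> occupies the half-open interval from 0 to
  \<open>snd (\<omega> 0)\<close>, which contains time 0 only if that holding time is
  positive.\<close>

lemma hitting_time_self:
  assumes "0 < snd (\<omega> 0)"
  shows "hitting_time z z \<omega> = 0"
proof (rule antisym)
  have "walk_at z \<omega> 0 z"
    using assms by (auto simp: walk_at_def jump_time_def intro!: exI[of _ 0])
  then show "hitting_time z z \<omega> \<le> 0"
    unfolding hitting_time_def zero_ereal_def by (intro Inf_lower) auto
  show "0 \<le> hitting_time z z \<omega>"
    unfolding hitting_time_def by (intro Inf_greatest) auto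
qed

text \<open>Prepending the step \<open>(f, t)\<close> moves every later stay by \<open>t\<close>,
  and the new first stay is spent at \<open>a\<close>, which differs from \<open>z\<close>. The
  visits to \<open>z\<close> are therefore those of the walk from \<open>f a\<close>, translated by
  \<open>t\<close>.\<close>

lemma hitting_time_first_step:
  assumes "a \<noteq> z" and pos: "0 \<le> t" "\<And>i. 0 \<le> snd (\<omega> i)"
  shows "hitting_time z a (case_nat (f, t) \<omega>) = ereal t + hitting_time z (f a) \<omega>"
proof -
  have chain: "jump_chain a (case_nat (f, t) \<omega>) (Suc n) = jump_chain (f a) \<omega> n" for n
    by (induction n) auto
  have time: "jump_time (case_nat (f, t) \<omega>) (Suc n) = t + jump_time \<omega> n" for n
    by (simp add: jump_time_def sum.lessThan_Suc_shift del: sum.lessThan_Suc)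
  have nonneg: "0 \<le> jump_time \<omega> n" for n
    using pos by (auto simp: jump_time_def intro!: sum_nonneg)
  have shift: "walk_at a (case_nat (f, t) \<omega>) s z \<longleftrightarrow> walk_at (f a) \<omega> (s - t) z" for s
  proof
    assume "walk_at a (case_nat (f, t) \<omega>) s z"
    then obtain n where n: "jump_time (case_nat (f, t) \<omega>) n \<le> s"
      "s < jump_time (case_nat (f, t) \<omega>) (Suc n)" "jump_chain a (case_nat (f, t) \<omega>) n = z"
      by (auto simp: walk_at_def)
    with \<open>a \<noteq> z\<close> obtain k where "n = Suc k"
      by (cases n) auto
    with n show "walk_at (f a) \<omega> (s - t) z"
      unfolding walk_at_def by (intro exI[of _ k]) (simp only: chain time, simp)
  next
    assume "walk_at (f a) \<omega> (s - t) z"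
    then obtain n where "jump_time \<omega> n \<le> s - t" "s - t < jump_time \<omega> (Suc n)"
      "jump_chain (f a) \<omega> n = z"
      by (auto simp: walk_at_def)
    then show "walk_at a (case_nat (f, t) \<omega>) s z"
      unfolding walk_at_def by (intro exI[of _ "Suc n"]) (simp only: chain time, simp)
  qed
  have "{s. 0 \<le> s \<and> walk_at a (case_nat (f, t) \<omega>) s z} = (+) t ` {s. 0 \<le> s \<and> walk_at (f a) \<omega> s z}"
  proof (intro set_eqI iffI)
    fix s assume "s \<in> {s. 0 \<le> s \<and> walk_at a (case_nat (f, t) \<omega>) s z}"
    then have w: "walk_at (f a) \<omega> (s - t) z"
      by (simp add: shift)
    \<comment> \<open>A visit cannot begin before time 0 when holding times are nonnegative, so the
      translation respects the restriction to nonnegative times.\<close>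
    then obtain n where "jump_time \<omega> n \<le> s - t"
      by (auto simp: walk_at_def)
    with nonneg[of n] have "0 \<le> s - t"
      by linarith
    with w show "s \<in> (+) t ` {s. 0 \<le> s \<and> walk_at (f a) \<omega> s z}"
      by (intro image_eqI[of _ _ "s - t"]) auto
  qed (use pos in \<open>auto simp: shift\<close>)
  then have "hitting_time z a (case_nat (f, t) \<omega>)
      = (INF s \<in> {s. 0 \<le> s \<and> walk_at (f a) \<omega> s z}. ereal t + ereal s)"
    by (simp add: hitting_time_def image_image)
  \<comment> \<open>Translation commutes with the infimum of a nonempty set; if \<open>z\<close> is
    never visited, both sides are infinite.\<close>
  also have "\<dots> = ereal t + hitting_time z (f a) \<omega>"
  proof (cases "{s. 0 \<le> s \<and> walk_at (f a) \<omega> s z} = {}")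
    case False
    then show ?thesis
      unfolding hitting_time_def by (intro INF_ereal_add_right) auto
  next
    case True
    show ?thesis
      unfolding hitting_time_def True by (simp add: top_ereal_def)
  qed
  finally show ?thesis .
qed

text \<open>For measurability, the infimum over uncountably many times is replaced by one over
  countably many stays. The \<open>n\<close>-th stay meets the nonnegative times iff
  \<open>max 0 (jump_time \<omega> n)\<close> precedes its end, and then this is its earliest such
  time. The \<open>max\<close> covers paths with negative holding times, which form a null set but
  belong to the space.\<close>

lemma hitting_time_eq_INF:
  "hitting_time z a \<omega> = (INF n. if jump_chain a \<omega> n = z
      \<and> max 0 (jump_time \<omega> n) < jump_time \<omega> (Suc n) then ereal (max 0 (jump_time \<omega> n)) else \<infinity>)"
    (is "_ = (INF n. ?f n)")
proof (rule antisym)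
  show "hitting_time z a \<omega> \<le> (INF n. ?f n)"
  proof (rule INF_greatest)
    fix n
    have "walk_at a \<omega> (max 0 (jump_time \<omega> n)) z"
      if "jump_chain a \<omega> n = z" "max 0 (jump_time \<omega> n) < jump_time \<omega> (Suc n)"
      using that unfolding walk_at_def by (intro exI[of _ n]) auto
    then show "hitting_time z a \<omega> \<le> ?f n"
      unfolding hitting_time_def by (auto simp del: ereal_max max_less_iff_conj intro!: Inf_lower imageI)
  qed
  show "(INF n. ?f n) \<le> hitting_time z a \<omega>"
    unfolding hitting_time_def
  proof (intro Inf_greatest, clarify)
    fix t assume "0 \<le> t" "walk_at a \<omega> t z"
    then obtain n where "jump_time \<omega> n \<le> t" "t < jump_time \<omega> (Suc n)" "jump_chain a \<omega> n = z"
      by (auto simp: walk_at_def)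
    with \<open>0 \<le> t\<close> show "(INF n. ?f n) \<le> ereal t"
      by (intro INF_lower2[of n]) auto
  qed
qed

section \<open>Probability laws and measurability for the walk\<close>

lemma prob_space_step_law: "prob_space (step_law G)"
proof -
  interpret E: prob_space expo by (rule prob_space_expo)
  interpret pair_prob_space "measure_pmf (Pi_pmf (pverts G) undefined (\<lambda>v. pmf_of_set (neighbors G v)))" expo ..
  show ?thesis
    unfolding step_law_def by (rule prob_space_axioms)
qed

lemma sequence_space_step_law: "sequence_space (step_law G)"
  unfolding sequence_space_def by (intro product_prob_spaceI prob_space_step_law)

lemma prob_space_walk_law: "prob_space (walk_law G)"
  unfolding walk_law_def by (intro prob_space_PiM prob_space_step_law)

lemma measurable_walk_law_component [measurable]: "(\<lambda>\<omega>. \<omega> n) \<in> walk_law G \<rightarrow>\<^sub>M step_law G"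
  unfolding walk_law_def by measurable

lemma measurable_step_law_fst [measurable]: "fst \<in> step_law G \<rightarrow>\<^sub>M count_space UNIV"
proof -
  have "fst \<in> step_law G \<rightarrow>\<^sub>M measure_pmf (Pi_pmf (pverts G) undefined (\<lambda>v. pmf_of_set (neighbors G v)))"
    unfolding step_law_def by measurable
  then show ?thesis
    by (simp cong: measurable_cong_sets)
qed

lemma measurable_step_law_snd [measurable]: "snd \<in> borel_measurable (step_law G)"
  unfolding step_law_def by measurable

lemma measurable_jump_chain [measurable]: "(\<lambda>\<omega>. jump_chain a \<omega> n) \<in> walk_law G \<rightarrow>\<^sub>M count_space UNIV"
proof (induction n)
  case (Suc n)
  have "(\<lambda>\<omega>. fst (\<omega> n) v) \<in> walk_law G \<rightarrow>\<^sub>M count_space UNIV" for v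
    by (rule measurable_compose[OF measurable_compose[OF measurable_walk_law_component measurable_step_law_fst]]) simp
  \<comment> \<open>The random map is evaluated at a random vertex; splitting over the countably
    many vertices reduces this to evaluation at fixed ones.\<close>
  then show ?case
    unfolding jump_chain.simps by (rule measurable_compose_countable) (rule Suc)
qed simp

lemma measurable_jump_time [measurable]: "(\<lambda>\<omega>. jump_time \<omega> n) \<in> borel_measurable (walk_law G)"
  unfolding jump_time_def by measurable

lemma measurable_hitting_time_fixed [measurable]: "hitting_time z a \<in> borel_measurable (walk_law G)"
  unfolding hitting_time_eq_INF[abs_def] by measurable

text \<open>After the first jump the starting vertex is itself random, so measurability is needed
  jointly in start and path.\<close>

lemma measurable_hitting_time [measurable (raw)]:
  assumes "f \<in> M \<rightarrow>\<^sub>M count_space UNIV" "g \<in> M \<rightarrow>\<^sub>M walk_law G"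
  shows "(\<lambda>x. hitting_time z (f x) (g x)) \<in> borel_measurable M"
  by (rule measurable_compose_countable[OF _ assms(1)])
     (rule measurable_compose[OF assms(2) measurable_hitting_time_fixed])

lemma AE_step_law_pos: "AE s in step_law G. 0 < snd s"
proof -
  interpret E: prob_space expo by (rule prob_space_expo)
  interpret pair_sigma_finite
    "measure_pmf (Pi_pmf (pverts G) undefined (\<lambda>v. pmf_of_set (neighbors G v)))" expo ..
  show ?thesis
    unfolding step_law_def using AE_expo_pos by (intro AE_pair_measure) auto
qed

lemma AE_walk_law_pos: "AE \<omega> in walk_law G. \<forall>i. 0 < snd (\<omega> i)"
proof -
  have "AE \<omega> in walk_law G. 0 < snd (\<omega> i)" for i
    unfolding walk_law_def by (intro AE_PiM_component prob_space_step_law AE_step_law_pos) auto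
  then show ?thesis
    by (simp add: AE_all_countable)
qed

section \<open>Laws of hitting times, exponential delays and duels\<close>

definition hit_law :: "('v::countable) pair_pre_digraph \<Rightarrow> 'v \<Rightarrow> 'v \<Rightarrow> ereal measure" where
  "hit_law G z a = distr (walk_law G) borel (hitting_time z a)"

text \<open>The law of the time still missing right after the first jump out of \<open>a\<close>: a
  uniform neighbor and an independent fresh path.\<close>

definition jump_law :: "('v::countable) pair_pre_digraph \<Rightarrow> 'v \<Rightarrow> 'v \<Rightarrow> ereal measure" where
  "jump_law G z a =
     distr (measure_pmf (pmf_of_set (neighbors G a)) \<Otimes>\<^sub>M walk_law G) borel
       (\<lambda>(v, \<omega>). hitting_time z v \<omega>)"

definition delay :: "ereal measure \<Rightarrow> ereal measure" where
  "delay L = distr (expo \<Otimes>\<^sub>M L) borel (\<lambda>(t, m). ereal t + m)"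

text \<open>The probability that an independent sample of \<open>M\<close> comes before one of
  \<open>N\<close>, ties counted one half. The iterated form lets either law be rewritten
  separately.\<close>

definition duel :: "ereal measure \<Rightarrow> ereal measure \<Rightarrow> ennreal" where
  "duel M N = (\<integral>\<^sup>+m. (\<integral>\<^sup>+n. score m n \<partial>N) \<partial>M)"

lemma measurable_fst_pmf_pair [measurable]:
  "fst \<in> (measure_pmf p \<Otimes>\<^sub>M M) \<rightarrow>\<^sub>M count_space UNIV"
proof -
  have "fst \<in> (measure_pmf p \<Otimes>\<^sub>M M) \<rightarrow>\<^sub>M measure_pmf p"
    by measurable
  then show ?thesis
    by (simp cong: measurable_cong_sets)
qed

lemma sets_hit_law [measurable_cong, simp]: "sets (hit_law G z a) = sets borel"
  by (simp add: hit_law_def)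

lemma sets_jump_law [measurable_cong, simp]: "sets (jump_law G z a) = sets borel"
  by (simp add: jump_law_def)

lemma sets_delay [measurable_cong, simp]: "sets (delay L) = sets borel"
  by (simp add: delay_def)

lemma measurable_hitting_time_pair [measurable]:
  "(\<lambda>(v, \<omega>). hitting_time z v \<omega>) \<in> borel_measurable (measure_pmf p \<Otimes>\<^sub>M walk_law G)"
  unfolding case_prod_beta by measurable

lemma prob_space_hit_law: "prob_space (hit_law G z a)"
  unfolding hit_law_def by (intro prob_space.prob_space_distr prob_space_walk_law) measurable

lemma prob_space_jump_law: "prob_space (jump_law G z a)"
proof -
  interpret W: prob_space "walk_law G" by (rule prob_space_walk_law)
  interpret pair_prob_space "measure_pmf (pmf_of_set (neighbors G a))" "walk_law G" ..
  show ?thesis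
    unfolding jump_law_def by (intro prob_space_distr) measurable
qed

lemma prob_space_delay:
  assumes "prob_space L" and [measurable_cong]: "sets L = sets borel"
  shows "prob_space (delay L)"
proof -
  interpret L: prob_space L by fact
  interpret E: prob_space expo by (rule prob_space_expo)
  interpret pair_prob_space expo L ..
  show ?thesis
    unfolding delay_def by (intro prob_space_distr) measurable
qed

lemma nn_integral_jump_law_pmf:
  assumes [measurable]: "\<phi> \<in> borel_measurable borel"
  shows "(\<integral>\<^sup>+m. \<phi> m \<partial>jump_law G z a)
    = (\<integral>\<^sup>+v. (\<integral>\<^sup>+\<omega>. \<phi> (hitting_time z v \<omega>) \<partial>walk_law G) \<partial>pmf_of_set (neighbors G a))"
proof -
  interpret W: prob_space "walk_law G" by (rule prob_space_walk_law)
  show ?thesis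
    unfolding jump_law_def by (simp add: nn_integral_distr W.nn_integral_fst[symmetric])
qed

lemma nn_integral_jump_law:
  assumes [measurable]: "\<phi> \<in> borel_measurable borel"
    and nbrs: "neighbors G a \<noteq> {}" "finite (neighbors G a)"
  shows "(\<integral>\<^sup>+m. \<phi> m \<partial>jump_law G z a)
    = (\<Sum>v\<in>neighbors G a. \<integral>\<^sup>+m. \<phi> m \<partial>hit_law G z v) / card (neighbors G a)"
  using nbrs
  by (simp add: nn_integral_jump_law_pmf nn_integral_pmf_of_set hit_law_def nn_integral_distr)

lemma nn_integral_delay:
  assumes [measurable]: "\<phi> \<in> borel_measurable borel"
    and L: "prob_space L" and [measurable_cong]: "sets L = sets borel"
  shows "(\<integral>\<^sup>+m. \<phi> m \<partial>delay L) = (\<integral>\<^sup>+m. (\<integral>\<^sup>+t. \<phi> (ereal t + m) \<partial>expo) \<partial>L)"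
proof -
  interpret L: prob_space L by fact
  interpret E: prob_space expo by (rule prob_space_expo)
  interpret pair_sigma_finite expo L ..
  have "(\<integral>\<^sup>+m. \<phi> m \<partial>delay L) = (\<integral>\<^sup>+x. \<phi> (ereal (fst x) + snd x) \<partial>(expo \<Otimes>\<^sub>M L))"
    unfolding delay_def by (simp add: nn_integral_distr case_prod_beta)
  also have "\<dots> = (\<integral>\<^sup>+m. (\<integral>\<^sup>+t. \<phi> (ereal t + m) \<partial>expo) \<partial>L)"
    by (subst nn_integral_snd[symmetric]) auto
  finally show ?thesis .
qed

text \<open>An i.i.d. sequence has the law of one step put in front of an independent sequence with
  the same law; this is \<open>PiM_iter\<close>.\<close>

lemma nn_integral_walk_law:
  assumes [measurable]: "g \<in> borel_measurable (walk_law G)"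
  shows "(\<integral>\<^sup>+\<omega>. g \<omega> \<partial>walk_law G) = (\<integral>\<^sup>+s. (\<integral>\<^sup>+\<omega>. g (case_nat s \<omega>) \<partial>walk_law G) \<partial>step_law G)"
proof -
  interpret sequence_space "step_law G" by (rule sequence_space_step_law)
  interpret W: prob_space "walk_law G" by (rule prob_space_walk_law)
  have W: "walk_law G = S"
    by (simp add: walk_law_def)
  have [measurable]: "(\<lambda>(s, \<omega>). case_nat s \<omega>) \<in> step_law G \<Otimes>\<^sub>M walk_law G \<rightarrow>\<^sub>M walk_law G"
    unfolding W by measurable
  have g: "(\<lambda>x. g (case x of (s, \<omega>) \<Rightarrow> case_nat s \<omega>))
      \<in> borel_measurable (step_law G \<Otimes>\<^sub>M walk_law G)"
    by (rule measurable_compose[OF _ assms]) measurable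
  have "(\<integral>\<^sup>+\<omega>. g \<omega> \<partial>walk_law G)
      = (\<integral>\<^sup>+\<omega>. g \<omega> \<partial>distr (step_law G \<Otimes>\<^sub>M walk_law G) (walk_law G) (\<lambda>(s, \<omega>). case_nat s \<omega>))"
    unfolding W PiM_iter ..
  also have "\<dots> = (\<integral>\<^sup>+x. g (case x of (s, \<omega>) \<Rightarrow> case_nat s \<omega>) \<partial>(step_law G \<Otimes>\<^sub>M walk_law G))"
    by (rule nn_integral_distr) measurable
  also have "\<dots> = (\<integral>\<^sup>+s. (\<integral>\<^sup>+\<omega>. g (case_nat s \<omega>) \<partial>walk_law G) \<partial>step_law G)"
    using W.nn_integral_fst[OF g] by simp
  finally show ?thesis .
qed

lemma hit_law_self: "AE m in hit_law G z z. m = 0"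
  unfolding hit_law_def
proof (subst AE_distr_iff)
  show "AE \<omega> in walk_law G. hitting_time z z \<omega> = 0"
    using AE_walk_law_pos[of G] by eventually_elim (simp add: hitting_time_self)
qed measurable

text \<open>The Markov property at the first jump: holding time, chosen neighbor and remaining path
  are independent, and \<open>hitting_time_first_step\<close> adds the holding time to the remaining
  hitting time.\<close>

lemma hit_law_first_step:
  assumes "a \<noteq> z" and fin: "finite (pverts G)" and a: "a \<in> pverts G"
  shows "hit_law G z a = delay (jump_law G z a)"
proof (rule measure_eqI)
  fix A assume "A \<in> sets (hit_law G z a)"
  then have [measurable]: "A \<in> sets borel" by simp
  let ?K = "Pi_pmf (pverts G) undefined (\<lambda>v. pmf_of_set (neighbors G v))"
  let ?p = "pmf_of_set (neighbors G a)"
  let ?\<phi> = "indicator A :: ereal \<Rightarrow> ennreal"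
  interpret W: prob_space "walk_law G" by (rule prob_space_walk_law)
  interpret E: prob_space expo by (rule prob_space_expo)
  interpret J: prob_space "jump_law G z a" by (rule prob_space_jump_law)
  interpret EW: pair_sigma_finite expo "walk_law G" ..
  have eval: "(\<lambda>s. fst s a) \<in> measure_pmf ?K \<Otimes>\<^sub>M expo \<rightarrow>\<^sub>M count_space UNIV"
    by (rule measurable_compose[OF measurable_fst_pmf_pair]) simp
  have [measurable]: "(\<lambda>x. fst (fst x) a)
      \<in> (measure_pmf ?K \<Otimes>\<^sub>M expo) \<Otimes>\<^sub>M walk_law G \<rightarrow>\<^sub>M count_space UNIV"
    by (rule measurable_compose[OF measurable_fst eval])
  have \<phi>: "(\<lambda>s. \<integral>\<^sup>+\<omega>. ?\<phi> (ereal (snd s) + hitting_time z (fst s a) \<omega>) \<partial>walk_law G)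
      \<in> borel_measurable (measure_pmf ?K \<Otimes>\<^sub>M expo)"
    by measurable
  have step: "(\<integral>\<^sup>+\<omega>. ?\<phi> (hitting_time z a (case_nat (f, t) \<omega>)) \<partial>walk_law G)
      = (\<integral>\<^sup>+\<omega>. ?\<phi> (ereal t + hitting_time z (f a) \<omega>) \<partial>walk_law G)" if "0 < t" for f t
    using AE_walk_law_pos[of G] that \<open>a \<noteq> z\<close>
    by (intro nn_integral_cong_AE)
       (auto simp: hitting_time_first_step less_imp_le elim!: eventually_mono)
  have "emeasure (hit_law G z a) A = (\<integral>\<^sup>+m. ?\<phi> m \<partial>hit_law G z a)"
    by simp
  also have "\<dots> = (\<integral>\<^sup>+\<omega>. ?\<phi> (hitting_time z a \<omega>) \<partial>walk_law G)"
    unfolding hit_law_def by (rule nn_integral_distr) measurable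
  also have "\<dots> = (\<integral>\<^sup>+s. (\<integral>\<^sup>+\<omega>. ?\<phi> (hitting_time z a (case_nat s \<omega>)) \<partial>walk_law G) \<partial>step_law G)"
    by (intro nn_integral_walk_law) measurable
  also have "\<dots> = (\<integral>\<^sup>+s. (\<integral>\<^sup>+\<omega>. ?\<phi> (ereal (snd s) + hitting_time z (fst s a) \<omega>) \<partial>walk_law G) \<partial>step_law G)"
    using AE_step_law_pos[of G]
    by (intro nn_integral_cong_AE) (auto simp: step split_beta elim!: eventually_mono)
  also have "\<dots> = (\<integral>\<^sup>+f. (\<integral>\<^sup>+t. (\<integral>\<^sup>+\<omega>. ?\<phi> (ereal t + hitting_time z (f a) \<omega>) \<partial>walk_law G) \<partial>expo) \<partial>?K)"
    unfolding step_law_def using E.nn_integral_fst[OF \<phi>] by simp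
  \<comment> \<open>Of the random map \<open>f\<close> only the value at \<open>a\<close> matters
    now, and that marginal of the product is uniform on the neighbors of \<open>a\<close>.\<close>
  also have "\<dots> = (\<integral>\<^sup>+v. (\<integral>\<^sup>+t. (\<integral>\<^sup>+\<omega>. ?\<phi> (ereal t + hitting_time z v \<omega>) \<partial>walk_law G) \<partial>expo)
      \<partial>map_pmf (\<lambda>f. f a) ?K)"
    by simp
  also have "map_pmf (\<lambda>f. f a) ?K = ?p"
    using fin a by (simp add: Pi_pmf_component)
  also have "(\<integral>\<^sup>+v. (\<integral>\<^sup>+t. (\<integral>\<^sup>+\<omega>. ?\<phi> (ereal t + hitting_time z v \<omega>) \<partial>walk_law G) \<partial>expo) \<partial>?p)
      = (\<integral>\<^sup>+v. (\<integral>\<^sup>+\<omega>. (\<integral>\<^sup>+t. ?\<phi> (ereal t + hitting_time z v \<omega>) \<partial>expo) \<partial>walk_law G) \<partial>?p)"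
    by (intro nn_integral_cong EW.Fubini'[symmetric]) measurable
  also have "\<dots> = (\<integral>\<^sup>+m. (\<integral>\<^sup>+t. ?\<phi> (ereal t + m) \<partial>expo) \<partial>jump_law G z a)"
    by (intro nn_integral_jump_law_pmf[symmetric]) measurable
  also have "\<dots> = emeasure (delay (jump_law G z a)) A"
    by (subst nn_integral_delay[symmetric]) (auto simp: J.prob_space_axioms)
  finally show "emeasure (hit_law G z a) A = emeasure (delay (jump_law G z a)) A" .
qed simp

text \<open>The integrated form of \<open>score_delay\<close>: of two delayed arrivals, a fair coin
  decides which one is released from its delay first.\<close>

lemma duel_delay:
  assumes M: "prob_space M" and sM [measurable_cong]: "sets M = sets borel"
    and N: "prob_space N" and sN [measurable_cong]: "sets N = sets borel"
  shows "duel (delay M) (delay N) = ennreal (1/2) * duel M (delay N) + ennreal (1/2) * duel (delay M) N"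
proof -
  interpret M: prob_space M by fact
  interpret N: prob_space N by fact
  interpret E: prob_space expo by (rule prob_space_expo)
  interpret EN: pair_sigma_finite expo N ..
  interpret D: prob_space "delay N" by (intro prob_space_delay M N sM sN)
  have right: "(\<integral>\<^sup>+n. score m n \<partial>delay N) = (\<integral>\<^sup>+n. (\<integral>\<^sup>+t. score m (ereal t + n) \<partial>expo) \<partial>N)" for m
    by (intro nn_integral_delay N sN) measurable
  have left: "duel (delay M) L = (\<integral>\<^sup>+m. (\<integral>\<^sup>+s. (\<integral>\<^sup>+n. score (ereal s + m) n \<partial>L) \<partial>expo) \<partial>M)"
    if "prob_space L" and [measurable_cong]: "sets L = sets borel" for L
  proof -
    interpret L: prob_space L by fact
    show ?thesis
      unfolding duel_def by (intro nn_integral_delay M sM) measurable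
  qed
  have "duel (delay M) (delay N)
      = (\<integral>\<^sup>+m. (\<integral>\<^sup>+s. (\<integral>\<^sup>+n. (\<integral>\<^sup>+t. score (ereal s + m) (ereal t + n) \<partial>expo) \<partial>N) \<partial>expo) \<partial>M)"
    by (simp add: left D.prob_space_axioms right)
  \<comment> \<open>Both clocks are moved innermost, so that \<open>score_delay\<close> applies for
    fixed \<open>m\<close> and \<open>n\<close>.\<close>
  also have "\<dots> = (\<integral>\<^sup>+m. (\<integral>\<^sup>+n. (\<integral>\<^sup>+s. (\<integral>\<^sup>+t. score (ereal s + m) (ereal t + n) \<partial>expo) \<partial>expo) \<partial>N) \<partial>M)"
    by (intro nn_integral_cong EN.Fubini'[symmetric]) measurable
  also have "\<dots> = (\<integral>\<^sup>+m. (\<integral>\<^sup>+n. ennreal (1/2) * (\<integral>\<^sup>+t. score m (ereal t + n) \<partial>expo)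
      + ennreal (1/2) * (\<integral>\<^sup>+s. score (ereal s + m) n \<partial>expo) \<partial>N) \<partial>M)"
    by (simp only: score_delay)
  also have "\<dots> = ennreal (1/2) * (\<integral>\<^sup>+m. (\<integral>\<^sup>+n. (\<integral>\<^sup>+t. score m (ereal t + n) \<partial>expo) \<partial>N) \<partial>M)
      + ennreal (1/2) * (\<integral>\<^sup>+m. (\<integral>\<^sup>+n. (\<integral>\<^sup>+s. score (ereal s + m) n \<partial>expo) \<partial>N) \<partial>M)"
    by (simp add: nn_integral_add nn_integral_cmult)
  also have "(\<integral>\<^sup>+m. (\<integral>\<^sup>+n. (\<integral>\<^sup>+t. score m (ereal t + n) \<partial>expo) \<partial>N) \<partial>M) = duel M (delay N)"
    by (simp add: duel_def right)
  also have "(\<integral>\<^sup>+m. (\<integral>\<^sup>+n. (\<integral>\<^sup>+s. score (ereal s + m) n \<partial>expo) \<partial>N) \<partial>M)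
      = (\<integral>\<^sup>+m. (\<integral>\<^sup>+s. (\<integral>\<^sup>+n. score (ereal s + m) n \<partial>N) \<partial>expo) \<partial>M)"
    by (intro nn_integral_cong EN.Fubini') measurable
  also have "\<dots> = duel (delay M) N"
    by (simp add: left N sN)
  finally show ?thesis .
qed

subsection \<open>The recursion for first-passage probabilities\<close>

text \<open>Links the payoffs, stated on the product of path spaces, with the laws on the extended
  reals, where the recursion is available.\<close>

lemma first_passage_prob_eq_duel:
  "ennreal (first_passage_prob G z a b) = duel (hit_law G z a) (hit_law G z b)"
proof -
  interpret W: prob_space "walk_law G" by (rule prob_space_walk_law)
  interpret WW: pair_prob_space "walk_law G" "walk_law G" ..
  let ?WW = "walk_law G \<Otimes>\<^sub>M walk_law G"
  let ?s = "\<lambda>x. hitting_time z a (fst x)" and ?t = "\<lambda>x. hitting_time z b (snd x)"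
  let ?L = "{x \<in> space ?WW. ?s x < ?t x}" and ?E = "{x \<in> space ?WW. ?s x = ?t x}"
  have score_measurable: "(\<lambda>x. score (?s x) (?t x)) \<in> borel_measurable ?WW"
    by measurable
  have "duel (hit_law G z a) (hit_law G z b)
      = (\<integral>\<^sup>+\<omega>. (\<integral>\<^sup>+\<omega>'. score (hitting_time z a \<omega>) (hitting_time z b \<omega>') \<partial>walk_law G) \<partial>walk_law G)"
    by (simp add: duel_def hit_law_def nn_integral_distr)
  also have "\<dots> = (\<integral>\<^sup>+x. score (?s x) (?t x) \<partial>?WW)"
    using W.nn_integral_fst[OF score_measurable] by simp
  also have "\<dots> = (\<integral>\<^sup>+x. indicator ?L x + ennreal (1/2) * indicator ?E x \<partial>?WW)"
    by (intro nn_integral_cong) (auto simp: score_def indicator_def)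
  also have "\<dots> = emeasure ?WW ?L + ennreal (1/2) * emeasure ?WW ?E"
    by (subst nn_integral_add) (auto simp: nn_integral_cmult)
  also have "\<dots> = ennreal (measure ?WW ?L + 1/2 * measure ?WW ?E)"
    by (subst ennreal_plus) (simp_all only: WW.emeasure_eq_measure ennreal_mult zero_le_divide_1_iff
        measure_nonneg zero_le_numeral mult_nonneg_nonneg)
  finally show ?thesis
    by (simp add: first_passage_prob_def)
qed

lemma first_passage_prob_nonneg: "0 \<le> first_passage_prob G z a b"
  by (simp add: first_passage_prob_def)

text \<open>Pointwise, \<open>score m n + score n m = 1\<close>; Fubini brings both duels to the
  same order of integration.\<close>

lemma duel_swap:
  assumes M: "prob_space M" and [measurable_cong]: "sets M = sets borel"
    and N: "prob_space N" and [measurable_cong]: "sets N = sets borel"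
  shows "duel M N + duel N M = 1"
proof -
  interpret M: prob_space M by fact
  interpret N: prob_space N by fact
  interpret MN: pair_sigma_finite M N ..
  have "ennreal (1/2) + ennreal (1/2) = 1"
    by (subst ennreal_plus[symmetric]) auto
  then have score: "score m n + score n m = 1" for m n
    by (auto simp: score_def)
  have "duel N M = (\<integral>\<^sup>+m. (\<integral>\<^sup>+n. score n m \<partial>N) \<partial>M)"
    unfolding duel_def by (intro MN.Fubini') measurable
  then have "duel M N + duel N M = (\<integral>\<^sup>+m. (\<integral>\<^sup>+n. score m n + score n m \<partial>N) \<partial>M)"
    by (simp add: duel_def nn_integral_add)
  then show ?thesis
    by (simp add: score M.emeasure_space_1 N.emeasure_space_1)
qed

lemma first_passage_prob_swap: "first_passage_prob G z b a = 1 - first_passage_prob G z a b"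
proof -
  have "ennreal (first_passage_prob G z a b + first_passage_prob G z b a) = 1"
    by (subst ennreal_plus)
       (simp_all add: first_passage_prob_nonneg first_passage_prob_eq_duel duel_swap prob_space_hit_law)
  then show ?thesis
    by simp
qed

lemma first_passage_prob_same [simp]: "first_passage_prob G z a a = 1 / 2"
  using first_passage_prob_swap[of G z a a] by simp

text \<open>The first holding time is a positive lower bound for the hitting time of any other
  vertex.\<close>

lemma hit_law_pos:
  assumes "a \<noteq> z"
  shows "AE m in hit_law G z a. 0 < m"
  unfolding hit_law_def
proof (subst AE_distr_iff)
  show "AE \<omega> in walk_law G. 0 < hitting_time z a \<omega>"
    using AE_walk_law_pos[of G]
  proof eventually_elim
    fix \<omega> :: "'a walk_path" assume pos: "\<forall>i. 0 < snd (\<omega> i)"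
    have "\<omega> = case_nat (fst (\<omega> 0), snd (\<omega> 0)) (\<lambda>i. \<omega> (Suc i))"
      by (auto simp: fun_eq_iff split: nat.split)
    then have "hitting_time z a \<omega>
        = ereal (snd (\<omega> 0)) + hitting_time z (fst (\<omega> 0) a) (\<lambda>i. \<omega> (Suc i))"
      using hitting_time_first_step[OF assms] pos by (metis less_imp_le)
    moreover have "0 \<le> hitting_time z (fst (\<omega> 0) a) (\<lambda>i. \<omega> (Suc i))"
      unfolding hitting_time_def by (intro Inf_greatest) auto
    moreover have "0 < ereal (snd (\<omega> 0))"
      using pos by simp
    ultimately show "0 < hitting_time z a \<omega>"
      by (metis add_pos_nonneg)
  qed
qed measurable

text \<open>Boundary values for the recursion: one arrival time is 0, the other almost surely
  positive.\<close>

lemma first_passage_prob_at_target: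
  assumes "b \<noteq> z"
  shows "first_passage_prob G z z b = 1" "first_passage_prob G z b z = 0"
proof -
  interpret Z: prob_space "hit_law G z z" by (rule prob_space_hit_law)
  interpret B: prob_space "hit_law G z b" by (rule prob_space_hit_law)
  have "AE n in hit_law G z b. score 0 n = 1"
    using hit_law_pos[OF assms, of G] by eventually_elim (simp add: score_def)
  then have "(\<integral>\<^sup>+n. score 0 n \<partial>hit_law G z b) = (\<integral>\<^sup>+n. 1 \<partial>hit_law G z b)"
    by (rule nn_integral_cong_AE)
  then have one: "(\<integral>\<^sup>+n. score 0 n \<partial>hit_law G z b) = 1"
    by (simp add: B.emeasure_space_1)
  have "AE m in hit_law G z z. (\<integral>\<^sup>+n. score m n \<partial>hit_law G z b) = 1"
    using hit_law_self[of G z] by eventually_elim (simp add: one)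
  then have "duel (hit_law G z z) (hit_law G z b) = (\<integral>\<^sup>+m. 1 \<partial>hit_law G z z)"
    unfolding duel_def by (rule nn_integral_cong_AE)
  then have "ennreal (first_passage_prob G z z b) = 1"
    by (simp add: first_passage_prob_eq_duel Z.emeasure_space_1)
  then show "first_passage_prob G z z b = 1"
    by simp
  then show "first_passage_prob G z b z = 0"
    by (simp add: first_passage_prob_swap[of G z b z])
qed

lemma duel_jump_law_left:
  assumes N: "prob_space N" and [measurable_cong]: "sets N = sets borel"
    and nbrs: "neighbors G a \<noteq> {}" "finite (neighbors G a)"
  shows "duel (jump_law G z a) N = (\<Sum>v\<in>neighbors G a. duel (hit_law G z v) N) / card (neighbors G a)"
proof -
  interpret N: prob_space N by fact
  show ?thesis
    unfolding duel_def by (intro nn_integral_jump_law nbrs) measurable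
qed

lemma duel_jump_law_right:
  assumes [measurable_cong]: "sets M = sets borel"
    and nbrs: "neighbors G b \<noteq> {}" "finite (neighbors G b)"
  shows "duel M (jump_law G z b) = (\<Sum>w\<in>neighbors G b. duel M (hit_law G z w)) / card (neighbors G b)"
proof -
  have [measurable]: "(\<lambda>m. \<integral>\<^sup>+n. score m n \<partial>hit_law G z w) \<in> borel_measurable M" for w
  proof -
    interpret prob_space "hit_law G z w" by (rule prob_space_hit_law)
    show ?thesis by measurable
  qed
  have "duel M (jump_law G z b)
      = (\<integral>\<^sup>+m. (\<Sum>w\<in>neighbors G b. \<integral>\<^sup>+n. score m n \<partial>hit_law G z w) / card (neighbors G b) \<partial>M)"
    unfolding duel_def by (intro nn_integral_cong nn_integral_jump_law nbrs) measurable
  also have "\<dots> = (\<Sum>w\<in>neighbors G b. duel M (hit_law G z w)) / card (neighbors G b)"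
    by (simp add: duel_def nn_integral_divide nn_integral_sum)
  finally show ?thesis .
qed

lemma ennreal_sum_divide_card:
  assumes "finite A" "A \<noteq> {}" "\<And>x. x \<in> A \<Longrightarrow> 0 \<le> f x"
  shows "(\<Sum>x\<in>A. ennreal (f x)) / of_nat (card A) = ennreal ((\<Sum>x\<in>A. f x) / real (card A))"
proof -
  have "0 < card A"
    using assms by (simp add: card_gt_0_iff)
  then show ?thesis
    using assms by (simp add: sum_ennreal divide_ennreal[symmetric] sum_nonneg ennreal_of_nat_eq_real_of_nat)
qed

text \<open>Off the target both hitting laws are delayed jump laws, so \<open>duel_delay\<close>
  applies; a duel with a jump law is the average of the duels over the neighbors.\<close>

lemma first_passage_prob_first_jump:
  assumes fin: "finite (pverts G)" and ab: "a \<in> pverts G" "b \<in> pverts G" "a \<noteq> z" "b \<noteq> z"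
    and na: "neighbors G a \<noteq> {}" "finite (neighbors G a)"
    and nb: "neighbors G b \<noteq> {}" "finite (neighbors G b)"
  shows "first_passage_prob G z a b =
      ((\<Sum>v\<in>neighbors G a. first_passage_prob G z v b) / card (neighbors G a)
      + (\<Sum>w\<in>neighbors G b. first_passage_prob G z a w) / card (neighbors G b)) / 2"
    (is "_ = (?l + ?r) / 2")
proof -
  let ?H = "hit_law G z" and ?J = "jump_law G z"
  have H: "?H a = delay (?J a)" "?H b = delay (?J b)"
    using fin ab by (auto intro: hit_law_first_step)
  have nonneg: "0 \<le> ?l" "0 \<le> ?r"
    by (auto intro!: divide_nonneg_nonneg sum_nonneg first_passage_prob_nonneg)
  have "duel (?H a) (?H b) = ennreal (1/2) * duel (?J a) (?H b) + ennreal (1/2) * duel (?H a) (?J b)"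
    unfolding H by (intro duel_delay prob_space_jump_law sets_jump_law)
  also have "\<dots> = ennreal (1/2) * ennreal ?l + ennreal (1/2) * ennreal ?r"
    by (subst duel_jump_law_left[OF prob_space_hit_law sets_hit_law na],
        subst duel_jump_law_right[OF sets_hit_law nb])
       (simp only: first_passage_prob_eq_duel[symmetric]
          ennreal_sum_divide_card[OF na(2,1) first_passage_prob_nonneg]
          ennreal_sum_divide_card[OF nb(2,1) first_passage_prob_nonneg])
  also have "\<dots> = ennreal ((?l + ?r) / 2)"
    using nonneg by (rule ennreal_average)
  finally show ?thesis
    using nonneg by (simp add: first_passage_prob_eq_duel[symmetric] first_passage_prob_nonneg)
qed

text \<open>Two vertices off the target with the same neighbors have the same jump law, hence the
  same hitting law. This identifies sibling leaves when neither is the target.\<close>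

lemma first_passage_prob_same_neighbors:
  assumes "finite (pverts G)" "a \<in> pverts G" "a' \<in> pverts G" "a \<noteq> z" "a' \<noteq> z"
    and "neighbors G a = neighbors G a'"
  shows "first_passage_prob G z a b = first_passage_prob G z a' b"
    "first_passage_prob G z b a = first_passage_prob G z b a'"
proof -
  have "jump_law G z a = jump_law G z a'"
    using assms by (simp add: jump_law_def)
  then have "hit_law G z a = hit_law G z a'"
    using assms by (simp add: hit_law_first_step)
  then have "ennreal (first_passage_prob G z a b) = ennreal (first_passage_prob G z a' b)"
    by (simp add: first_passage_prob_eq_duel)
  then show "first_passage_prob G z a b = first_passage_prob G z a' b"
    by (simp add: first_passage_prob_nonneg)
  then show "first_passage_prob G z b a = first_passage_prob G z b a'"
    using first_passage_prob_swap[of G z a b] first_passage_prob_swap[of G z a' b] by simp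
qed

subsection \<open>The double star\<close>

text \<open>Labels are parameters so that each symmetry of the graph becomes a reinterpretation of
  the locale with permuted labels. The leaves \<open>l\<close>, \<open>l'\<close> hang on
  \<open>u\<close>, and \<open>m\<close>, \<open>m'\<close> on \<open>u'\<close>.\<close>

locale labelled_double_star =
  fixes G :: "('v::countable) pair_pre_digraph" and u u' l l' m m' :: 'v
  assumes distinct: "distinct [u, u', l, l', m, m']"
    and verts: "pverts G = {u, u', l, l', m, m'}"
    and nbrs: "neighbors G u = {u', l, l'}" "neighbors G u' = {u, m, m'}"
      "neighbors G l = {u}" "neighbors G l' = {u}"
      "neighbors G m = {u'}" "neighbors G m' = {u'}"
begin

lemma neqs [simp]:
  "u \<noteq> u'" "u \<noteq> l" "u \<noteq> l'" "u \<noteq> m" "u \<noteq> m'"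
  "u' \<noteq> u" "u' \<noteq> l" "u' \<noteq> l'" "u' \<noteq> m" "u' \<noteq> m'"
  "l \<noteq> u" "l \<noteq> u'" "l \<noteq> l'" "l \<noteq> m" "l \<noteq> m'"
  "l' \<noteq> u" "l' \<noteq> u'" "l' \<noteq> l" "l' \<noteq> m" "l' \<noteq> m'"
  "m \<noteq> u" "m \<noteq> u'" "m \<noteq> l" "m \<noteq> l'" "m \<noteq> m'"
  "m' \<noteq> u" "m' \<noteq> u'" "m' \<noteq> l" "m' \<noteq> l'" "m' \<noteq> m"
  using distinct by auto

lemma vertex [simp]: "u \<in> pverts G" "u' \<in> pverts G" "l \<in> pverts G" "l' \<in> pverts G"
    "m \<in> pverts G" "m' \<in> pverts G"
  by (simp_all add: verts)

lemma swap_leaves: "labelled_double_star G u u' l' l m m'"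
  by unfold_locales (use distinct verts nbrs in auto)

lemma swap_sides: "labelled_double_star G u' u m m' l l'"
  by unfold_locales (use distinct verts nbrs in auto)

abbreviation q :: "'v \<Rightarrow> 'v \<Rightarrow> 'v \<Rightarrow> real" where
  "q \<equiv> first_passage_prob G"

lemma first_jump:
  assumes "a \<in> pverts G" "b \<in> pverts G" "a \<noteq> z" "b \<noteq> z"
  shows "q z a b = ((\<Sum>v\<in>neighbors G a. q z v b) / card (neighbors G a)
      + (\<Sum>w\<in>neighbors G b. q z a w) / card (neighbors G b)) / 2"
  using assms by (intro first_passage_prob_first_jump) (auto simp: verts nbrs)

lemma same_neighbors:
  assumes "a \<in> pverts G" "b \<in> pverts G" "a \<noteq> z" "b \<noteq> z" "neighbors G a = neighbors G b"
  shows "q z a c = q z b c" "q z c a = q z c b"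
  using first_passage_prob_same_neighbors[of G a b z c] assms by (auto simp: verts)

lemma hub_target:
  "q u l u' = 4 / 5" "q u l m = 9 / 10" "q u u' m = 7 / 12"
proof -
  have leaf: "q u x m' = q u x m" "q u m' x = q u m x" "q u x l' = q u x l" "q u l' x = q u l x" for x
    by (auto intro!: same_neighbors simp: nbrs)
  \<comment> \<open>The recursion with denominators cleared: 2 for the coin, 3 for the degree of a
    hub. The first two equations form a closed system; the third involves only boundary values and
    halves.\<close>
  have "6 * q u l u' = 3 * q u u u' + q u l u + q u l m + q u l m'"
    by (subst first_jump) (simp_all add: nbrs field_simps)
  moreover have "2 * q u l m = q u u m + q u l u'"
    by (subst first_jump) (simp_all add: nbrs field_simps)
  moreover have "6 * q u u' m = q u u m + q u m m + q u m' m + 3 * q u u' u'"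
    by (subst first_jump) (simp_all add: nbrs field_simps)
  moreover have "q u u u' = 1" "q u u m = 1" "q u l u = 0"
    by (simp_all add: first_passage_prob_at_target)
  ultimately show "q u l u' = 4 / 5" "q u l m = 9 / 10" "q u u' m = 7 / 12"
    unfolding leaf first_passage_prob_same by - linarith+
qed

text \<open>With \<open>m'\<close> merged into \<open>m\<close>, four vertices remain off the target
  \<open>l\<close>; their six unordered pairs give six unknowns. The leaf \<open>l'\<close> stays
  separate, as its sibling is the target.\<close>

lemma leaf_target:
  "q l u u' = 305 / 453" "q l u l' = 339 / 604" "q l u m = 425 / 604"
  "q l u' m = 645 / 1208" "q l u' l' = 111 / 302" "q l l' m = 807 / 1208"
proof -
  have leaf: "q l x m' = q l x m" "q l m' x = q l m x" for x
    by (auto intro!: same_neighbors simp: nbrs)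
  have swap: "q l u' u = 1 - q l u u'" "q l l' u = 1 - q l u l'" "q l m u = 1 - q l u m"
    "q l m u' = 1 - q l u' m" "q l l' u' = 1 - q l u' l'" "q l m l' = 1 - q l l' m"
    by (rule first_passage_prob_swap)+
  have "6 * q l u u' = q l u' u' + q l l u' + q l l' u' + q l u u + q l u m + q l u m'"
    by (subst first_jump) (simp_all add: nbrs field_simps)
  moreover have "6 * q l u l' = q l u' l' + q l l l' + q l l' l' + 3 * q l u u"
    by (subst first_jump) (simp_all add: nbrs field_simps)
  moreover have "6 * q l u m = q l u' m + q l l m + q l l' m + 3 * q l u u'"
    by (subst first_jump) (simp_all add: nbrs field_simps)
  moreover have "6 * q l u' m = q l u m + q l m m + q l m' m + 3 * q l u' u'"
    by (subst first_jump) (simp_all add: nbrs field_simps)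
  moreover have "6 * q l u' l' = q l u l' + q l m l' + q l m' l' + 3 * q l u' u"
    by (subst first_jump) (simp_all add: nbrs field_simps)
  moreover have "2 * q l l' m = q l u m + q l l' u'"
    by (subst first_jump) (simp_all add: nbrs field_simps)
  moreover have "q l l u' = 1" "q l l l' = 1" "q l l m = 1"
    by (simp_all add: first_passage_prob_at_target)
  ultimately have eqs: "6 * q l u u' = 3 - q l u' l' + 2 * q l u m" "6 * q l u l' = q l u' l' + 3"
    "6 * q l u m = q l u' m + 1 + q l l' m + 3 * q l u u'" "6 * q l u' m = q l u m + 5 / 2"
    "6 * q l u' l' = q l u l' + 5 - 2 * q l l' m - 3 * q l u u'"
    "2 * q l l' m = q l u m + 1 - q l u' l'"
    unfolding leaf swap first_passage_prob_same by simp_all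
  \<comment> \<open>Four unknowns are eliminated, leaving a pair of equations in
    \<open>q l u m\<close> and \<open>q l u' l'\<close>.\<close>
  have "52 * q l u m + 12 * q l u' l' = 41" "26 * q l u' l' + 12 * q l u m = 18"
    using eqs by - linarith+
  with eqs show "q l u u' = 305 / 453" "q l u l' = 339 / 604" "q l u m = 425 / 604"
    "q l u' m = 645 / 1208" "q l u' l' = 111 / 302" "q l l' m = 807 / 1208"
    by - linarith+
qed

section \<open>The advantage matrix\<close>

lemma advantage_eq:
  "advantage G a b = q u a b + q u' a b + q l a b + q l' a b + q m a b + q m' a b - 3"
  by (simp add: advantage_def payoff_def verts)

lemma advantage_same: "advantage G a a = 0"
  by (simp add: advantage_eq)

lemma advantage_swap: "advantage G b a = - advantage G a b"
  by (simp add: advantage_eq first_passage_prob_swap[of G _ a b])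


text \<open>One representative for each class of unordered pairs of distinct vertices under the
  symmetries. The zeros belong to pairs that some symmetry exchanges.\<close>

lemma advantage_values:
  "advantage G u u' = 0" "advantage G u l = 385 / 1812" "advantage G u m = - 19 / 755"
  "advantage G l l' = 0" "advantage G l m = 0"
proof -
  \<comment> \<open>\<open>L\<close>, \<open>S\<close> and \<open>T\<close> move the leaf target to
    \<open>l'\<close>, \<open>m\<close> and \<open>m'\<close>; \<open>S\<close> also moves the hub
    target to \<open>u'\<close>.\<close>
  interpret L: labelled_double_star G u u' l' l m m' by (rule swap_leaves)
  interpret S: labelled_double_star G u' u m m' l l' by (rule swap_sides)
  interpret T: labelled_double_star G u' u m' m l l' by (rule S.swap_leaves)
  have at: "q z z b = 1" "q z b z = 0" if "b \<noteq> z" for z b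
    using that by (simp_all add: first_passage_prob_at_target)
  show "advantage G u u' = 0"
  proof -
    have "q m u u' = 1 - q m u' u" "q m' u u' = 1 - q m' u' u"
      by (rule first_passage_prob_swap)+
    moreover have "q u u u' = 1" "q u' u u' = 0"
      by (simp_all add: at)
    ultimately show ?thesis
      using leaf_target(1) L.leaf_target(1) S.leaf_target(1) T.leaf_target(1)
      unfolding advantage_eq by linarith
  qed
  show "advantage G u l = 385 / 1812"
  proof -
    have "q u u l = 1" "q l u l = 0"
      by (simp_all add: at)
    then show ?thesis
      using S.hub_target(3) L.leaf_target(2) S.leaf_target(4) T.leaf_target(4)
      unfolding advantage_eq by linarith
  qed
  show "advantage G u m = - 19 / 755"
  proof -
    have "q u' u m = 1 - q u' m u"
      by (rule first_passage_prob_swap)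
    moreover have "q u u m = 1" "q m u m = 0"
      by (simp_all add: at)
    ultimately show ?thesis
      using S.hub_target(1) leaf_target(3) L.leaf_target(3) T.leaf_target(5)
      unfolding advantage_eq by linarith
  qed
  show "advantage G l l' = 0"
  proof -
    have half: "q z l l' = 1 / 2" if "z \<noteq> l" "z \<noteq> l'" for z
      using that same_neighbors(1)[of l l' z l'] by (simp add: nbrs)
    have "q l l l' = 1" "q l' l l' = 0"
      by (simp_all add: at)
    then show ?thesis
      by (simp add: advantage_eq half)
  qed
  show "advantage G l m = 0"
  proof -
    have "q u' l m = 1 - q u' m l" "q m' l m = 1 - q m' m l"
      by (rule first_passage_prob_swap)+
    moreover have "q l l m = 1" "q m l m = 0"
      by (simp_all add: at)
    ultimately show ?thesis
      using hub_target(2) S.hub_target(2) L.leaf_target(6) T.leaf_target(6)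
      unfolding advantage_eq by linarith
  qed
qed

lemma advantage_table:
  "advantage G u u' = 0" "advantage G u' u = 0"
  "advantage G u l = 385 / 1812" "advantage G u l' = 385 / 1812"
  "advantage G u m = - 19 / 755" "advantage G u m' = - 19 / 755"
  "advantage G u' m = 385 / 1812" "advantage G u' m' = 385 / 1812"
  "advantage G u' l = - 19 / 755" "advantage G u' l' = - 19 / 755"
  "advantage G l u = - 385 / 1812" "advantage G l' u = - 385 / 1812"
  "advantage G m u = 19 / 755" "advantage G m' u = 19 / 755"
  "advantage G m u' = - 385 / 1812" "advantage G m' u' = - 385 / 1812"
  "advantage G l u' = 19 / 755" "advantage G l' u' = 19 / 755"
  "advantage G l l' = 0" "advantage G l' l = 0" "advantage G m m' = 0" "advantage G m' m = 0"
  "advantage G l m = 0" "advantage G l m' = 0" "advantage G l' m = 0" "advantage G l' m' = 0"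
  "advantage G m l = 0" "advantage G m l' = 0" "advantage G m' l = 0" "advantage G m' l' = 0"
proof -
  \<comment> \<open>Together with the identity, the seven interpretations run through the symmetry
    group of order 8.\<close>
  interpret L: labelled_double_star G u u' l' l m m' by (rule swap_leaves)
  interpret S: labelled_double_star G u' u m m' l l' by (rule swap_sides)
  interpret SL: labelled_double_star G u' u m' m l l' by (rule S.swap_leaves)
  interpret LS: labelled_double_star G u' u m m' l' l by (rule L.swap_sides)
  interpret LSL: labelled_double_star G u' u m' m l' l by (rule LS.swap_leaves)
  interpret LSLS: labelled_double_star G u u' l' l m' m by (rule LSL.swap_sides)
  interpret SLS: labelled_double_star G u u' l l' m' m by (rule SL.swap_sides)
  note entries = advantage_values L.advantage_values S.advantage_values SL.advantage_values
    LS.advantage_values LSL.advantage_values LSLS.advantage_values SLS.advantage_values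
  show "advantage G u u' = 0" "advantage G u' u = 0"
    "advantage G u l = 385 / 1812" "advantage G u l' = 385 / 1812"
    "advantage G u m = - 19 / 755" "advantage G u m' = - 19 / 755"
    "advantage G u' m = 385 / 1812" "advantage G u' m' = 385 / 1812"
    "advantage G u' l = - 19 / 755" "advantage G u' l' = - 19 / 755"
    "advantage G l l' = 0" "advantage G l' l = 0" "advantage G m m' = 0" "advantage G m' m = 0"
    "advantage G l m = 0" "advantage G l m' = 0" "advantage G l' m = 0" "advantage G l' m' = 0"
    "advantage G m l = 0" "advantage G m l' = 0" "advantage G m' l = 0" "advantage G m' l' = 0"
    by (rule entries)+
  show "advantage G l u = - 385 / 1812" "advantage G l' u = - 385 / 1812"
    "advantage G m u = 19 / 755" "advantage G m' u = 19 / 755"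
    "advantage G m u' = - 385 / 1812" "advantage G m' u' = - 385 / 1812"
    "advantage G l u' = 19 / 755" "advantage G l' u' = 19 / 755"
    by (subst advantage_swap, simp add: entries)+
qed

section \<open>Equilibria and optimal strategies\<close>

text \<open>The game is symmetric and zero-sum, so at an equilibrium no vertex has a positive
  advantage over \<open>a\<close>. Yet each hub loses to the leaves of the other hub, and each leaf
  loses to its own hub.\<close>

lemma not_pure_nash: "\<not> pure_nash G a b"
proof
  assume nash: "pure_nash G a b"
  then have ab: "a \<in> pverts G" "b \<in> pverts G"
    by (simp_all add: pure_nash_def)
  have opt: "advantage G v b \<le> advantage G a b" "advantage G v a \<le> advantage G b a"
    if "v \<in> pverts G" for v
    using nash that by (auto simp: pure_nash_def advantage_def)
  have "0 \<le> advantage G a b"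
    using opt(1)[OF ab(2)] by (simp add: advantage_same)
  moreover have "advantage G b a = - advantage G a b"
    by (rule advantage_swap)
  ultimately have "advantage G v a \<le> 0" if "v \<in> pverts G" for v
    using opt(2)[OF that] by linarith
  then have "advantage G u a \<le> 0" "advantage G u' a \<le> 0" "advantage G m a \<le> 0" "advantage G l a \<le> 0"
    by simp_all
  with ab(1) show False
    by (auto simp: verts advantage_table)
qed

lemma optimal_iff:
  "\<mu> \<in> optimal_strategies G \<longleftrightarrow>
    (\<exists>p::real. 228 / 2153 \<le> p \<and> p \<le> 1925 / 2153 \<and>
      (\<forall>v. pmf \<mu> v = p * pmf (return_pmf u) v + (1 - p) * pmf (return_pmf u') v))"
proof
  assume opt: "\<mu> \<in> optimal_strategies G"
  then have support: "set_pmf \<mu> \<subseteq> pverts G"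
    and adv: "\<And>b. b \<in> pverts G \<Longrightarrow> 0 \<le> (\<Sum>a\<in>pverts G. pmf \<mu> a * advantage G a b)"
    by (auto simp: optimal_strategies_def)
  have "(\<Sum>v\<in>pverts G. pmf \<mu> v) = 1"
    using support by (intro sum_pmf_eq_1) (auto simp: verts)
  then have total: "pmf \<mu> u + pmf \<mu> u' + pmf \<mu> l + pmf \<mu> l' + pmf \<mu> m + pmf \<mu> m' = 1"
    by (simp add: verts)
  have row: "0 \<le> pmf \<mu> u * advantage G u b + pmf \<mu> u' * advantage G u' b + pmf \<mu> l * advantage G l b
      + pmf \<mu> l' * advantage G l' b + pmf \<mu> m * advantage G m b + pmf \<mu> m' * advantage G m' b"
    if "b \<in> pverts G" for b
    using adv[OF that] by (simp add: verts)
  have nonneg: "0 \<le> pmf \<mu> l" "0 \<le> pmf \<mu> l'" "0 \<le> pmf \<mu> m" "0 \<le> pmf \<mu> m'"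
    by simp_all
  \<comment> \<open>Adding the constraints against \<open>u\<close> and \<open>u'\<close> gives the
    total leaf mass the coefficient \<open>19 / 755 - 385 / 1812 < 0\<close>, so that mass is
    zero.\<close>
  have leaves: "pmf \<mu> l = 0" "pmf \<mu> l' = 0" "pmf \<mu> m = 0" "pmf \<mu> m' = 0"
    using row[OF vertex(1)] row[OF vertex(2)] nonneg
    unfolding advantage_table advantage_same by - linarith+
  \<comment> \<open>Against \<open>l\<close> the constraint bounds the mass of \<open>u\<close> from
    below, against \<open>m\<close> from above; the ratio 1925 : 228 gives the endpoints, with
    \<open>2153 = 1925 + 228\<close>.\<close>
  have bounds: "228 / 2153 \<le> pmf \<mu> u" "pmf \<mu> u \<le> 1925 / 2153" "pmf \<mu> u' = 1 - pmf \<mu> u"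
    using row[OF vertex(3)] row[OF vertex(5)] total
    unfolding advantage_table advantage_same leaves by - linarith+
  have "pmf \<mu> v = pmf \<mu> u * pmf (return_pmf u) v + (1 - pmf \<mu> u) * pmf (return_pmf u') v" for v
  proof (cases "v \<in> pverts G")
    case True
    then show ?thesis
      by (auto simp: verts leaves bounds(3))
  next
    case False
    then have "pmf \<mu> v = 0" "v \<noteq> u" "v \<noteq> u'"
      using support by (auto simp: set_pmf_iff verts)
    then show ?thesis
      by (auto simp:)
  qed
  with bounds show "\<exists>p::real. 228 / 2153 \<le> p \<and> p \<le> 1925 / 2153 \<and>
      (\<forall>v. pmf \<mu> v = p * pmf (return_pmf u) v + (1 - p) * pmf (return_pmf u') v)"
    by blast
next
  assume "\<exists>p::real. 228 / 2153 \<le> p \<and> p \<le> 1925 / 2153 \<and>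
      (\<forall>v. pmf \<mu> v = p * pmf (return_pmf u) v + (1 - p) * pmf (return_pmf u') v)"
  then obtain p :: real where p: "228 / 2153 \<le> p" "p \<le> 1925 / 2153"
    and pmf: "\<And>v. pmf \<mu> v = p * pmf (return_pmf u) v + (1 - p) * pmf (return_pmf u') v"
    by blast
  have "set_pmf \<mu> \<subseteq> pverts G"
    by (auto simp: set_pmf_iff pmf indicator_def verts split: if_splits)
  moreover have "0 \<le> (\<Sum>a\<in>pverts G. pmf \<mu> a * advantage G a b)" if "b \<in> pverts G" for b
    using that p by (auto simp: verts pmf pmf_return advantage_table advantage_same field_simps)
  ultimately show "\<mu> \<in> optimal_strategies G"
    by (simp add: optimal_strategies_def)
qed

end

lemma labelled_double_star_2_2:
  "labelled_double_star (double_star 2 2) Hub1 Hub2 (Leaf1 0) (Leaf1 1) (Leaf2 0) (Leaf2 1)"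
proof
  have two: "{..<2::nat} = {0, 1}" by auto
  show "pverts (double_star 2 2) = {Hub1, Hub2, Leaf1 0, Leaf1 1, Leaf2 0, Leaf2 1}"
    by (auto simp: double_star_def Let_def two)
  show "neighbors (double_star 2 2) Hub1 = {Hub2, Leaf1 0, Leaf1 1}"
    "neighbors (double_star 2 2) Hub2 = {Hub1, Leaf2 0, Leaf2 1}"
    "neighbors (double_star 2 2) (Leaf1 0) = {Hub1}" "neighbors (double_star 2 2) (Leaf1 1) = {Hub1}"
    "neighbors (double_star 2 2) (Leaf2 0) = {Hub2}" "neighbors (double_star 2 2) (Leaf2 1) = {Hub2}"
    by (auto simp: neighbors_def double_star_def Let_def two)
qed simp

theorem corollary3p2:
  fixes G :: "ds_vertex pair_pre_digraph"
  defines "G \<equiv> double_star 2 2"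
  shows "card (pverts G) = 6
    \<and> \<not> (\<exists>a b. pure_nash G a b)
    \<and> optimal_strategies G =
        {\<mu>. \<exists>p::real. 228 / 2153 \<le> p \<and> p \<le> 1925 / 2153 \<and>
           (\<forall>v. pmf \<mu> v = p * pmf (return_pmf Hub1) v + (1 - p) * pmf (return_pmf Hub2) v)}
    \<and> (\<forall>\<mu>\<in>optimal_strategies G. set_pmf \<mu> = {Hub1, Hub2})"
proof -
  interpret labelled_double_star G Hub1 Hub2 "Leaf1 0" "Leaf1 1" "Leaf2 0" "Leaf2 1"
    unfolding G_def by (rule labelled_double_star_2_2)
  have "set_pmf \<mu> = {Hub1, Hub2}" if \<mu>: "\<mu> \<in> optimal_strategies G" for \<mu>
  proof -
    obtain p :: real where p: "228 / 2153 \<le> p" "p \<le> 1925 / 2153"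
      and pmf: "\<And>v. pmf \<mu> v = p * pmf (return_pmf Hub1) v + (1 - p) * pmf (return_pmf Hub2) v"
      using \<mu> unfolding optimal_iff by blast
    \<comment> \<open>The bounds give \<open>0 < p\<close> and \<open>p < 1\<close>, so both hubs
      carry positive mass.\<close>
    from p show ?thesis
      by (auto simp: set_pmf_iff pmf indicator_def split: if_splits)
  qed
  moreover have "card (pverts G) = 6"
    by (simp add: verts)
  ultimately show ?thesis
    using not_pure_nash optimal_iff by blast
qed

end
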